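(* Let $p,q,r$ be integers with $0\le r<q<p$. Suppose that $p\notin C(q,r)$ and that $p\in C(t,r)$ for every integer $t$ with $q<t<p$. Then $$\{q+1,q+2,\ldots,p-1\}\subseteq C(q,r).$$
   Context: Three-row Chomp. A position is a triple $[p,q,r]$ of integers with $p\ge q\ge r\ge 0$ (row lengths). The moves from $[p,q,r]$ are: reduce the first row to length $a$ with $0\le a<p$, giving $[a,\min(a,q),\min(a,r)]$; reduce the second row to length $a$ with $0\le a<q$, giving $[p,a,\min(a,r)]$; reduce the third row to length $b$ with $0\le b<r$, giving $[p,q,b]$. The player who moves to $[0,0,0]$ loses. A $P$-position is a position from which the previous player wins, and an $N$-position is one from which the next player wins. Equivalently: $[0,0,0]$ is an $N$-position, and a position other than $[0,0,0]$ is a $P$-position if and only if no move from it leads to a $P$-position. The function $f$. For all integers $q\ge r\ge 0$ there is a unique integer $p>r$ such that either (i) $r<p<q$ and $[p,p,r]$ is a $P$-position, or (ii) $p\ge q$ and $[p,q,r]$ is a $P$-position. This integer is denoted $f(q,r)$. For integers $q\ge r\ge 0$, $C(q,r)=\{f(q,b): 0\le b<r\}$. *)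

theory Defs
  imports Main
begin

type_synonym position = "nat \<times> nat \<times> nat"

text \<open>Positions are the triples with \<open>p \<ge> q \<ge> r\<close>; moves preserve this condition.
  The formulas below make sense for all triples, but only positions are of interest.\<close>

inductive move :: "position \<Rightarrow> position \<Rightarrow> bool" where
  first_row: "a < p \<Longrightarrow> move (p, q, r) (a, min a q, min a r)"
| second_row: "a < q \<Longrightarrow> move (p, q, r) (p, a, min a r)"
| third_row: "b < r \<Longrightarrow> move (p, q, r) (p, q, b)"

lemma move_decreases:
  assumes "move x y"
  shows "(y, x) \<in> measure (\<lambda>(p, q, r). p + q + r)"
  using assms by (cases rule: move.cases) (auto simp: min_def)

function P_position :: "position \<Rightarrow> bool" where
  "P_position x \<longleftrightarrow> x \<noteq> (0, 0, 0) \<and> (\<forall>y. move x y \<longrightarrow> \<not> P_position y)"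
  by auto
termination
  by (relation "measure (\<lambda>(p, q, r). p + q + r)") (simp, erule move_decreases)

declare P_position.simps [simp del]

definition f :: "nat \<Rightarrow> nat \<Rightarrow> nat" where
  "f q r = (THE p. r < p \<and> (p < q \<and> P_position (p, p, r) \<or> q \<le> p \<and> P_position (p, q, r)))"

definition C :: "nat \<Rightarrow> nat \<Rightarrow> nat set" where
  "C q r = {f q b |b. b < r}"

end

theory Submission
  imports Defs
begin

text \<open>For \<open>q < t < p\<close> the hypothesis yields \<open>b\<^sub>t < r\<close> such that \<open>[p, t, b\<^sub>t]\<close> is a P-position. The
  position \<open>[p, q, b\<^sub>t]\<close> is reachable from it, hence has a move to a P-position. That move is not in
  the third row since \<open>p \<notin> C q r\<close>, and any other move except shortening the first row to some
  \<open>a > q\<close> is also available from \<open>[p, t, b\<^sub>t]\<close>. So \<open>f q b\<^sub>t\<close> lies strictly between \<open>q\<close> and \<open>p\<close>.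
  Since \<open>t \<mapsto> f q b\<^sub>t\<close> is injective, it permutes the integers strictly between \<open>q\<close> and \<open>p\<close>.\<close>

lemma P_position_no_move:
  assumes "P_position x" "P_position y"
  shows "\<not> move x y"
  using assms P_position.simps[of x] by blast

text \<open>\<open>0 < p\<close> excludes \<open>(0, 0, 0)\<close>, the only N-position without a
  move to a P-position.\<close>

lemma P_position_moveE:
  assumes "\<not> P_position (p, q, r)" "0 < p"
  obtains (first_row) a where "a < p" "P_position (a, min a q, min a r)"
  | (second_row) a where "a < q" "P_position (p, a, min a r)"
  | (third_row) b where "b < r" "P_position (p, q, b)"
proof -
  obtain y where "move (p, q, r) y" "P_position y"
    using assms P_position.simps[of "(p, q, r)"] by auto
  then show thesis
    by (cases rule: move.cases) (use that in auto)
qed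

text \<open>Shortening the larger first row to the smaller one would be a move between two
  P-positions; the third row survives because both first rows exceed \<open>r\<close>.\<close>

lemma P_position_first_row_unique:
  assumes "P_position (p, min p q, r)" "P_position (p', min p' q, r)" "r < p" "r < p'"
  shows "p = p'"
proof -
  have *: "\<not> a < c"
    if "P_position (c, min c q, r)" "P_position (a, min a q, r)" "r < a" for a c
  proof
    assume "a < c"
    then have "move (c, min c q, r) (a, min a (min c q), min a r)"
      by (rule move.first_row)
    moreover have "min a (min c q) = min a q" "min a r = r"
      using \<open>a < c\<close> \<open>r < a\<close> by auto
    ultimately show False
      using that P_position_no_move by metis
  qed
  show ?thesis
    using *[OF assms(1,2,4)] *[OF assms(2,1,3)] by simp
qed

lemma P_position_second_row_unique:
  assumes "P_position (p, q, r)" "P_position (p, q', r)" "r \<le> q" "r \<le> q'"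
  shows "q = q'"
proof -
  have *: "\<not> a < c" if "P_position (p, c, r)" "P_position (p, a, r)" "r \<le> a" for a c
    using that P_position_no_move move.second_row[of a c p r] by (auto simp: min_absorb2)
  show ?thesis
    using *[OF assms(1,2,4)] *[OF assms(2,1,3)] by simp
qed

lemma P_position_third_row_unique:
  assumes "P_position (p, q, r)" "P_position (p, q, r')"
  shows "r = r'"
  using assms P_position_no_move move.third_row linorder_neqE_nat by metis

text \<open>Strategy stealing: every reply to \<open>[a, a, a - 1]\<close> is already a move from \<open>[a, a, a]\<close>.\<close>
lemma not_P_position_rectangle: "\<not> P_position (a, a, a)"
proof
  assume P: "P_position (a, a, a)"
  then have pos: "0 < a"
    by (subst (asm) P_position.simps) auto
  have nP: "\<not> P_position y" if "move (a, a, a) y" for y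
    using P P_position_no_move that by blast
  have "\<not> P_position (a, a, a - 1)"
    using pos by (intro nP move.third_row) simp
  from this pos show False
  proof (cases rule: P_position_moveE)
    case (first_row c)
    then have "min c (a - 1) = min c a" by auto
    then show False
      using first_row nP[OF move.first_row[of c a a a]] by simp
  next
    case (second_row c)
    then have "min c (a - 1) = min c a" by auto
    then show False
      using second_row nP[OF move.second_row[of c a a a]] by simp
  next
    case (third_row c)
    then show False
      using nP[OF move.third_row[of c a a a]] by simp
  qed
qed

text \<open>Otherwise every \<open>[p, q, r]\<close> with \<open>p > q\<close> would have a move to
  a P-position that keeps the first row \<open>p\<close>. Only finitely many pairs of lower rows are
  available, so one pair would serve two values of \<open>p\<close>, against uniqueness.\<close>

lemma P_position_first_row_exists:
  assumes "r \<le> q"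
  shows "\<exists>p>r. P_position (p, min p q, r)"
proof (rule ccontr)
  assume none: "\<not> ?thesis"
  have "\<exists>z \<in> {..q} \<times> {..r}. P_position (p, z) \<and> snd z \<le> fst z" if "p \<in> {q<..}" for p
  proof -
    have "\<not> P_position (p, q, r)" "0 < p"
      using none[simplified, rule_format, of p] that assms by (auto simp: min_absorb2)
    then show ?thesis
    proof (cases rule: P_position_moveE)
      case (first_row a)
      \<comment> \<open>A value \<open>a > r\<close> would be the missing witness; for
        \<open>a \<le> r\<close> the move leaves the rectangle \<open>[a, a, a]\<close>.\<close>
      have "\<not> r < a"
        using first_row none by (auto simp: min_absorb2)
      then show ?thesis
        using first_row assms not_P_position_rectangle[of a] by (simp add: min_absorb1)
    next
      case (second_row a)
      then show ?thesis by (intro bexI[of _ "(a, min a r)"]) auto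
    next
      case (third_row b)
      then show ?thesis
        using assms by (intro bexI[of _ "(q, b)"]) auto
    qed
  qed
  then obtain z where z: "\<And>p. p \<in> {q<..} \<Longrightarrow>
      z p \<in> {..q} \<times> {..r} \<and> P_position (p, z p) \<and> snd (z p) \<le> fst (z p)"
    by metis
  have "inj_on z {q<..}"
  proof (rule inj_onI)
    fix p p' assume p: "p \<in> {q<..}" "p' \<in> {q<..}" "z p = z p'"
    obtain a b where ab: "z p = (a, b)" by fastforce
    \<comment> \<open>As \<open>b \<le> a \<le> q < p\<close>, and likewise for \<open>p'\<close>,
      uniqueness applies with \<open>a\<close> in the role of \<open>q\<close>.\<close>
    have "P_position (p, min p a, b)" "P_position (p', min p' a, b)" "b < p" "b < p'"
      using z[OF p(1)] z[OF p(2)] p ab by (auto simp: min_absorb2)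
    then show "p = p'" by (rule P_position_first_row_unique)
  qed
  moreover have "z ` {q<..} \<subseteq> {..q} \<times> {..r}"
    using z by blast
  ultimately have "finite {q<..}"
    using finite_subset finite_imageD by (metis finite_SigmaI finite_atMost)
  then show False
    by (simp add: infinite_Ioi)
qed

text \<open>The second row \<open>min p q\<close> merges the two cases in the definition of
  \<open>f\<close>; existence and uniqueness justify the description operator.\<close>

lemma f_eq_iff:
  assumes "r \<le> q"
  shows "f q r = p \<longleftrightarrow> r < p \<and> P_position (p, min p q, r)"
proof -
  have *: "p < q \<and> P_position (p, p, r) \<or> q \<le> p \<and> P_position (p, q, r)
      \<longleftrightarrow> P_position (p, min p q, r)" for p
    by (cases p q rule: linorder_cases) auto
  obtain p\<^sub>0 where p\<^sub>0: "r < p\<^sub>0" "P_position (p\<^sub>0, min p\<^sub>0 q, r)"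
    using P_position_first_row_exists[OF assms] by blast
  then have "f q r = p\<^sub>0"
    unfolding f_def * using P_position_first_row_unique by blast
  then show ?thesis
    using p\<^sub>0 P_position_first_row_unique by blast
qed

theorem lemma3p1:
  fixes p q r :: nat
  assumes "r < q" and "q < p"
    and "p \<notin> C q r"
    and "\<And>t. q < t \<Longrightarrow> t < p \<Longrightarrow> p \<in> C t r"
  shows "{q + 1..p - 1} \<subseteq> C q r"
proof -
  have "\<exists>b<r. P_position (p, t, b)" if t: "t \<in> {q<..<p}" for t
  proof -
    obtain b where "b < r" "f t b = p"
      using assms(4)[of t] t by (auto simp: C_def)
    then show ?thesis
      using f_eq_iff[of b t p] t assms(1) by (auto simp: min_absorb2)
  qed
  then obtain \<beta> where \<beta>: "\<And>t. t \<in> {q<..<p} \<Longrightarrow> \<beta> t < r \<and> P_position (p, t, \<beta> t)"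
    by metis
  have N: "\<not> P_position (p, q, b)" if "b < r" for b
    using that assms f_eq_iff[of b q p] by (auto simp: C_def min_absorb2)
  have between: "f q (\<beta> t) \<in> {q<..<p}" if t: "t \<in> {q<..<p}" for t
  proof -
    have b: "\<beta> t < r" and nP: "\<And>y. move (p, t, \<beta> t) y \<Longrightarrow> \<not> P_position y"
      using \<beta>[OF t] P_position_no_move by blast+
    have "0 < p" using assms(2) by simp
    with N[OF b] show ?thesis
    proof (cases rule: P_position_moveE)
      case (first_row a)
      have "q < a"
      proof (rule ccontr)
        assume "\<not> q < a"
        \<comment> \<open>With \<open>a \<le> q < t\<close>, both second rows are cut to
          \<open>a\<close>, which erases the difference between \<open>q\<close> and
          \<open>t\<close>.\<close>
        then have "min a q = min a t" using t by auto
        then show False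
          using first_row nP[OF move.first_row] by auto
      qed
      then show ?thesis
        using first_row b assms(1) f_eq_iff[of "\<beta> t" q a] by (auto simp: min_absorb2)
    next
      case (second_row a)
      then show ?thesis
        using t nP[OF move.second_row[of a]] by auto
    next
      case (third_row b')
      then show ?thesis
        using N[of b'] b by simp
    qed
  qed
  have "inj_on (\<lambda>t. f q (\<beta> t)) {q<..<p}"
  proof (rule inj_onI)
    fix s t assume s: "s \<in> {q<..<p}" and t: "t \<in> {q<..<p}" and eq: "f q (\<beta> s) = f q (\<beta> t)"
    \<comment> \<open>Equal values of \<open>f\<close> give equal first two rows, hence
      \<open>\<beta> s = \<beta> t\<close>; then \<open>[p, s, \<beta> s]\<close> and
      \<open>[p, t, \<beta> t]\<close> can differ only in the second row.\<close>
    have "P_position (f q (\<beta> s), min (f q (\<beta> s)) q, \<beta> s)"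
      "P_position (f q (\<beta> t), min (f q (\<beta> t)) q, \<beta> t)"
      using f_eq_iff[of "\<beta> s" q] f_eq_iff[of "\<beta> t" q] \<beta>[OF s] \<beta>[OF t] assms(1) by auto
    then have "\<beta> s = \<beta> t"
      unfolding eq by (rule P_position_third_row_unique)
    then show "s = t"
      using \<beta>[OF s] \<beta>[OF t] s t assms(1) P_position_second_row_unique[of p s "\<beta> s" t] by auto
  qed
  then have "(\<lambda>t. f q (\<beta> t)) ` {q<..<p} = {q<..<p}"
    using between by (intro endo_inj_surj) auto
  moreover have "(\<lambda>t. f q (\<beta> t)) ` {q<..<p} \<subseteq> C q r"
    using \<beta> by (auto simp: C_def)
  moreover have "{q + 1..p - 1} = {q<..<p}"
    using assms(2) by auto
  ultimately show ?thesis by simp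
qed

end
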